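(* Let $d\ge 1$ and let $\mathbf{s}=(s_1,\ldots,s_d)$ be a strictly increasing sequence of positive integers. Then $\mathbf{P}_d^{(\mathbf{s})}$ is Gorenstein of index $2$ if and only if $\mathbf{s}=\left(\frac{t_1}{2},\frac{t_2}{2},\ldots,\frac{t_d}{2}\right)$ for some sequence of positive integers $\mathbf{t}=(t_1,\ldots,t_d)$ such that $\mathbf{P}_d^{(\mathbf{t})}$ is reflexive up to translation. Moreover, there is no strictly increasing sequence $\mathbf{s}$ of positive integers such that $\mathbf{P}_d^{(\mathbf{s})}$ is Gorenstein of index $c$ with $c\ge 3$.
   Context: For a sequence of positive integers $\mathbf{s}=(s_1,\ldots,s_d)$, the $\mathbf{s}$-lecture hall polytope is $\mathbf{P}_d^{(\mathbf{s})}=\{\mathbf{x}\in\mathbb{R}^d : 0\le \frac{x_1}{s_1}\le\frac{x_2}{s_2}\le\cdots\le\frac{x_d}{s_d}\le 1\}$, a $d$-dimensional lattice polytope. A $d$-dimensional lattice polytope $\mathcal{P}\subset\mathbb{R}^d$ is Fano if $(\mathcal{P}\setminus\partial\mathcal{P})\cap\mathbb{Z}^d=\{\mathbf{0}\}$. It is reflexive if it is Fano and its dual polytope $\mathcal{P}^\vee=\{y\in\mathbb{R}^d : \langle x,y\rangle\le 1 \text{ for all } x\in\mathcal{P}\}$ is a lattice polytope. "Reflexive up to translation" means that some translate by a vector in $\mathbb{Z}^d$ is reflexive. Two $d$-dimensional lattice polytopes $\mathcal{P},\mathcal{Q}\subset\mathbb{R}^d$ are unimodularly equivalent if $\mathcal{Q}=f_U(\mathcal{P})+\mathbf{w}$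 for some $U\in\mathbb{Z}^{d\times d}$ with $\det U=\pm1$ and some $\mathbf{w}\in\mathbb{Z}^d$, where $f_U(\mathbf{v})=\mathbf{v}U$. For $c\in\mathbb{Z}_{>0}$, $\mathcal{P}$ is Gorenstein of index $c$ if $c\mathcal{P}=\{c\alpha:\alpha\in\mathcal{P}\}$ is unimodularly equivalent to a reflexive polytope. *)

theory Defs
  imports "HOL-Analysis.Analysis"
begin

text \<open>
  Vectors of \<open>\<real>\<^sup>d\<close> are elements of \<open>real ^ 'n\<close> with \<open>CARD('n) = d\<close>.  Where the order of the
  coordinates matters, \<open>'n\<close> is a finite linearly ordered type; as such it is order isomorphic to
  \<open>{1..d}\<close>, and \<open>d \<ge> 1\<close> because types are nonempty.
\<close>

definition integer_vector :: "real ^ 'n \<Rightarrow> bool" where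
  "integer_vector x \<longleftrightarrow> (\<forall>i. x $ i \<in> \<int>)"

definition lattice_polytope :: "(real ^ 'n) set \<Rightarrow> bool" where
  "lattice_polytope P \<longleftrightarrow>
     (\<exists>V. finite V \<and> (\<forall>v\<in>V. integer_vector v) \<and> P = convex hull V)"

definition full_dim_lattice_polytope :: "(real ^ 'n) set \<Rightarrow> bool" where
  "full_dim_lattice_polytope P \<longleftrightarrow> lattice_polytope P \<and> aff_dim P = int CARD('n)"

text \<open>
  The chain \<open>0 \<le> x\<^sub>1/s\<^sub>1 \<le> \<dots> \<le> x\<^sub>d/s\<^sub>d \<le> 1\<close> is written as the collection of all inequalities between
  its members.
\<close>

definition lecture_hall_polytope :: "('n \<Rightarrow> nat) \<Rightarrow> (real ^ 'n::{finite,linorder}) set" where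
  "lecture_hall_polytope s =
     {x. (\<forall>i. 0 \<le> x $ i / real (s i)) \<and>
         (\<forall>i j. i \<le> j \<longrightarrow> x $ i / real (s i) \<le> x $ j / real (s j)) \<and>
         (\<forall>i. x $ i / real (s i) \<le> 1)}"

definition fano :: "(real ^ 'n) set \<Rightarrow> bool" where
  "fano P \<longleftrightarrow>
     full_dim_lattice_polytope P \<and> (P - frontier P) \<inter> {x. integer_vector x} = {0}"

definition dual_polytope :: "(real ^ 'n) set \<Rightarrow> (real ^ 'n) set" where
  "dual_polytope P = {y. \<forall>x\<in>P. x \<bullet> y \<le> 1}"

definition reflexive :: "(real ^ 'n) set \<Rightarrow> bool" where
  "reflexive P \<longleftrightarrow> fano P \<and> lattice_polytope (dual_polytope P)"

definition reflexive_up_to_translation :: "(real ^ 'n) set \<Rightarrow> bool" where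
  "reflexive_up_to_translation P \<longleftrightarrow>
     (\<exists>w. integer_vector w \<and> reflexive ((\<lambda>x. x + w) ` P))"

definition unimodular_matrix :: "real ^ 'n ^ 'n \<Rightarrow> bool" where
  "unimodular_matrix U \<longleftrightarrow> (\<forall>i j. U $ i $ j \<in> \<int>) \<and> (det U = 1 \<or> det U = - 1)"

definition unimodularly_equivalent :: "(real ^ 'n) set \<Rightarrow> (real ^ 'n) set \<Rightarrow> bool" where
  "unimodularly_equivalent P Q \<longleftrightarrow>
     full_dim_lattice_polytope P \<and> full_dim_lattice_polytope Q \<and>
     (\<exists>U w. unimodular_matrix U \<and> integer_vector w \<and> Q = (\<lambda>v. v v* U + w) ` P)"

definition gorenstein_of_index :: "nat \<Rightarrow> (real ^ 'n) set \<Rightarrow> bool" where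
  "gorenstein_of_index c P \<longleftrightarrow>
     0 < c \<and> full_dim_lattice_polytope P \<and>
     (\<exists>Q. reflexive Q \<and> unimodularly_equivalent ((\<lambda>x. real c *\<^sub>R x) ` P) Q)"

end

theory Submission
  imports Defs
begin

text \<open>
  The \<open>c\<close>-th dilate of the polytope of \<open>s\<close> is the polytope of \<open>c s\<close>, and reflexivity is invariant
  under unimodular linear maps, so index \<open>c\<close> means exactly that the polytope of \<open>c s\<close> is reflexive
  up to translation.  If \<open>s\<close> is strictly increasing and \<open>c \<ge> 3\<close>, this fails because \<open>2s - 1\<close> and
  \<open>3s - 1\<close> are two distinct interior lattice points: \<open>k - 1/s\<^sub>i\<close> is strictly increasing in \<open>i\<close> and
  lies strictly between \<open>0\<close> and \<open>c\<close> for \<open>k = 2, 3\<close>.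
\<close>

section \<open>Integer matrices and their determinants\<close>

lemma det_Ints:
  fixes A :: "real ^ 'n ^ 'n"
  assumes "\<And>i j. A $ i $ j \<in> \<int>"
  shows "det A \<in> \<int>"
  unfolding det_def using assms by (intro Ints_sum Ints_mult Ints_prod) auto

text \<open>Cramer's rule writes each entry of the inverse as the determinant of an integer matrix
  divided by \<open>det U\<close>, and dividing by 1 or -1 preserves integrality.\<close>

lemma unimodular_matrix_inverse:
  fixes U :: "real ^ 'n ^ 'n"
  assumes "unimodular_matrix U"
  obtains V where "unimodular_matrix V" "U ** V = mat 1" "V ** U = mat 1"
proof -
  have int: "\<And>i j. U $ i $ j \<in> \<int>" and det: "det U = 1 \<or> det U = - 1"
    using assms by (auto simp: unimodular_matrix_def)
  then have nz: "det U \<noteq> 0" by auto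
  then obtain V where V: "U ** V = mat 1" "V ** U = mat 1"
    by (metis invertible_det_nz invertible_def)
  have "V $ k $ j \<in> \<int>" for k j
  proof -
    \<comment> \<open>The \<open>j\<close>-th column of \<open>V\<close> solves the linear system
      with matrix \<open>U\<close> and right-hand side \<open>axis j 1\<close>, which is the form
      needed for Cramer's rule.\<close>
    have "U *v (V *v axis j 1) = axis j 1"
      by (simp add: matrix_vector_mul_assoc V)
    then have *: "V *v axis j 1 = (\<chi> k. det (\<chi> i l. if l = k then (axis j 1 :: real ^ 'n) $ i else U $ i $ l) / det U)"
      using cramer[OF nz] by blast
    have "V $ k $ j = (V *v axis j 1) $ k"
      by (simp add: matrix_vector_mult_basis column_def)
    also have "\<dots> = det (\<chi> i l. if l = k then (axis j 1 :: real ^ 'n) $ i else U $ i $ l) / det U"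
      unfolding * by simp
    also have "\<dots> \<in> \<int>"
    proof -
      have "det (\<chi> i l. if l = k then (axis j 1 :: real ^ 'n) $ i else U $ i $ l) \<in> \<int>"
        by (rule det_Ints) (auto simp: int axis_def)
      then show ?thesis using det by auto
    qed
    finally show ?thesis .
  qed
  moreover have "det V = 1 \<or> det V = - 1"
    using det V(1) by (metis det_I det_mul mult.left_neutral mult_minus_left minus_equation_iff)
  ultimately show ?thesis using that V unfolding unimodular_matrix_def by blast
qed

lemma integer_vector_vector_matrix_mult:
  assumes "integer_vector x" "\<And>i j. U $ i $ j \<in> \<int>"
  shows "integer_vector (x v* U)"
  using assms by (auto simp: integer_vector_def vector_matrix_mult_def intro!: Ints_sum Ints_mult)

lemma integer_vector_matrix_vector_mult:
  assumes "integer_vector x" "\<And>i j. U $ i $ j \<in> \<int>"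
  shows "integer_vector (U *v x)"
  using assms by (auto simp: integer_vector_def matrix_vector_mult_def intro!: Ints_sum Ints_mult)

section \<open>Lattice polytopes and reflexivity under linear maps\<close>

lemma lattice_polytope_linear_image:
  assumes "lattice_polytope P" "linear f" "\<And>x. integer_vector x \<Longrightarrow> integer_vector (f x)"
  shows "lattice_polytope (f ` P)"
proof -
  obtain V where V: "finite V" "\<forall>v\<in>V. integer_vector v" "P = convex hull V"
    using assms(1) unfolding lattice_polytope_def by blast
  have "f ` P = convex hull (f ` V)"
    using V assms(2) convex_hull_linear_image by metis
  then show ?thesis
    unfolding lattice_polytope_def using V assms(3) by (intro exI[of _ "f ` V"]) auto
qed

lemma lattice_polytope_diff_frontier:
  assumes "lattice_polytope P"
  shows "P - frontier P = interior P"
proof -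
  have "closed P"
    using assms compact_imp_closed finite_imp_compact_convex_hull
    unfolding lattice_polytope_def by blast
  then show ?thesis using interior_subset by (auto simp: frontier_def)
qed

lemma fano_interior:
  assumes "fano P"
  shows "interior P \<inter> {x. integer_vector x} = {0}"
  using assms lattice_polytope_diff_frontier by (metis fano_def full_dim_lattice_polytope_def)

text \<open>Since \<open>U\<close> and its inverse are both integral, the map permutes the lattice
  points and carries interior to interior, so 0 remains the only interior lattice point. The dual is
  transformed by the inverse matrix acting on column vectors, which is again integral.\<close>

lemma reflexive_unimodular_image:
  fixes P :: "(real ^ 'n) set"
  assumes "reflexive P" "unimodular_matrix U"
  shows "reflexive ((\<lambda>v. v v* U) ` P)"
proof -
  let ?f = "\<lambda>v. v v* U"
  obtain V where V: "unimodular_matrix V" "U ** V = mat 1" "V ** U = mat 1"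
    using unimodular_matrix_inverse[OF assms(2)] .
  have intU: "\<And>i j. U $ i $ j \<in> \<int>" and intV: "\<And>i j. V $ i $ j \<in> \<int>"
    using assms(2) V(1) by (auto simp: unimodular_matrix_def)
  have lin: "linear ?f"
    by (simp add: linear_iff vector_matrix_left_distrib scaleR_vector_matrix_assoc)
  have fV: "v v* U v* V = v" "v v* V v* U = v" for v :: "real ^ 'n"
    by (simp_all add: vector_matrix_mul_assoc V)
  have inj: "inj ?f" by (metis fV(1) injI)
  have P: "lattice_polytope P" "aff_dim P = int CARD('n)" "lattice_polytope (dual_polytope P)"
    using assms(1) by (auto simp: reflexive_def fano_def full_dim_lattice_polytope_def)
  have latf: "lattice_polytope (?f ` P)"
    using lattice_polytope_linear_image[OF P(1) lin] integer_vector_vector_matrix_mult intU by blast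
  have dimf: "aff_dim (?f ` P) = int CARD('n)"
    using P(2) aff_dim_injective_linear_image[OF lin inj] by simp
  have int_iff: "integer_vector (?f v) \<longleftrightarrow> integer_vector v" for v
    using integer_vector_vector_matrix_mult[OF _ intU] integer_vector_vector_matrix_mult[OF _ intV] fV(1)
    by metis
  have "interior (?f ` P) = ?f ` interior P"
    by (rule interior_injective_linear_image[OF lin inj])
  then have "(?f ` P - frontier (?f ` P)) \<inter> {x. integer_vector x}
      = ?f ` (interior P \<inter> {x. integer_vector x})"
    using int_iff lattice_polytope_diff_frontier[OF latf] by auto
  also have "\<dots> = {0}"
    using assms(1) fano_interior[of P] by (simp add: reflexive_def)
  finally have fanof: "fano (?f ` P)"
    using latf dimf by (simp add: fano_def full_dim_lattice_polytope_def)
  have VU: "V *v (U *v y) = y" "U *v (V *v y) = y" for y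
    by (simp_all add: matrix_vector_mul_assoc V)
  \<comment> \<open>Row multiplication by \<open>U\<close> is adjoint to column multiplication by
    \<open>U\<close>, so the matrix moves to the other side of the inner product.\<close>
  have "dual_polytope (?f ` P) = {y. U *v y \<in> dual_polytope P}"
    by (simp add: dual_polytope_def dot_lmul_matrix)
  also have "\<dots> = (\<lambda>y. V *v y) ` dual_polytope P"
    using VU by (auto intro!: image_eqI[where f = "\<lambda>y. V *v y" and x = "U *v _"])
  finally have "lattice_polytope (dual_polytope (?f ` P))"
    using lattice_polytope_linear_image[OF P(3) matrix_vector_mul_linear, of V]
      integer_vector_matrix_vector_mult[OF _ intV] by simp
  with fanof show ?thesis by (simp add: reflexive_def)
qed

section \<open>Lecture hall polytopes as full-dimensional lattice polytopes\<close>

lemma lecture_hall_polytope_scaled: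
  fixes s :: "'n::{finite,linorder} \<Rightarrow> nat"
  assumes "0 < c"
  shows "(\<lambda>x. real c *\<^sub>R x) ` lecture_hall_polytope s = lecture_hall_polytope (\<lambda>i. c * s i)"
proof -
  have "x \<in> (\<lambda>x. real c *\<^sub>R x) ` lecture_hall_polytope s" if "x \<in> lecture_hall_polytope (\<lambda>i. c * s i)" for x
  proof (rule image_eqI)
    show "x = real c *\<^sub>R ((1 / real c) *\<^sub>R x)" using assms by simp
    show "(1 / real c) *\<^sub>R x \<in> lecture_hall_polytope s"
      using that by (simp add: lecture_hall_polytope_def)
  qed
  moreover have "real c *\<^sub>R x \<in> lecture_hall_polytope (\<lambda>i. c * s i)" if "x \<in> lecture_hall_polytope s" for x
    using that assms by (simp add: lecture_hall_polytope_def)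
  ultimately show ?thesis by blast
qed

lemma convex_lecture_hall_polytope: "convex (lecture_hall_polytope s)"
proof (rule convexI)
  fix x y and u v :: real
  assume *: "x \<in> lecture_hall_polytope s" "y \<in> lecture_hall_polytope s" "0 \<le> u" "0 \<le> v" "u + v = 1"
  have eq: "(u *\<^sub>R x + v *\<^sub>R y) $ i / real (s i) = u * (x $ i / real (s i)) + v * (y $ i / real (s i))" for i
    by (simp add: add_divide_distrib)
  show "u *\<^sub>R x + v *\<^sub>R y \<in> lecture_hall_polytope s"
    unfolding lecture_hall_polytope_def mem_Collect_eq eq
  proof (intro conjI allI impI)
    fix i j
    show "0 \<le> u * (x $ i / real (s i)) + v * (y $ i / real (s i))"
      using * by (intro add_nonneg_nonneg mult_nonneg_nonneg) (auto simp: lecture_hall_polytope_def)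
    show "u * (x $ i / real (s i)) + v * (y $ i / real (s i)) \<le> 1"
      using * by (intro convex_bound_le) (auto simp: lecture_hall_polytope_def)
    show "u * (x $ i / real (s i)) + v * (y $ i / real (s i)) \<le> u * (x $ j / real (s j)) + v * (y $ j / real (s j))"
      if "i \<le> j"
      using * that by (intro add_mono mult_left_mono) (auto simp: lecture_hall_polytope_def)
  qed
qed

lemma compact_lecture_hall_polytope:
  assumes "\<And>i. 0 < s i"
  shows "compact (lecture_hall_polytope s)"
proof -
  have "closed (lecture_hall_polytope s)"
    \<comment> \<open>In this form each ratio is visibly a coordinate times a constant, hence
      continuous.\<close>
    unfolding lecture_hall_polytope_def divide_inverse
    by (intro closed_Collect_conj closed_Collect_all closed_Collect_imp open_Collect_const
        closed_Collect_le continuous_intros)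
  moreover have "lecture_hall_polytope s \<subseteq> cbox 0 (\<chi> i. real (s i))"
    using assms by (simp add: subset_iff lecture_hall_polytope_def mem_box_cart pos_le_divide_eq pos_divide_le_eq)
  ultimately show ?thesis
    using bounded_cbox bounded_subset compact_eq_bounded_closed by blast
qed

text \<open>Finitely many strict inequalities between continuous functions cut out an open set, and
  that set lies inside the polytope.\<close>

lemma interior_lecture_hall_polytopeI:
  fixes x :: "real ^ 'n::{finite,linorder}"
  assumes "\<And>i. 0 < x $ i / real (s i)" "\<And>i. x $ i / real (s i) < 1"
    "\<And>i j. i < j \<Longrightarrow> x $ i / real (s i) < x $ j / real (s j)"
  shows "x \<in> interior (lecture_hall_polytope s)"
proof (rule interiorI)
  let ?S = "{x :: real ^ 'n::{finite,linorder}. (\<forall>i. 0 < x $ i / real (s i)) \<and>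
         (\<forall>i j. i < j \<longrightarrow> x $ i / real (s i) < x $ j / real (s j)) \<and> (\<forall>i. x $ i / real (s i) < 1)}"
  have "?S = (\<Inter>i. {x. 0 < x $ i / real (s i)}) \<inter>
       (\<Inter>i. \<Inter>j\<in>{i<..}. {x. x $ i / real (s i) < x $ j / real (s j)}) \<inter>
       (\<Inter>i. {x. x $ i / real (s i) < 1})"
    by auto
  also have "open \<dots>"
    unfolding divide_inverse
    by (intro open_Int open_INT ballI finite open_Collect_less continuous_intros)
  finally show "open ?S" .
  show "x \<in> ?S" using assms by auto
  show "?S \<subseteq> lecture_hall_polytope s"
    by (auto simp: lecture_hall_polytope_def order.order_iff_strict)
qed

text \<open>This makes the extreme points integral and finite in number, so that they can serve as
  the lattice points spanning the polytope.\<close>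

lemma extreme_point_lecture_hall_polytope:
  fixes x :: "real ^ 'n::{finite,linorder}"
  assumes pos: "\<And>i. 0 < s i" and ext: "x extreme_point_of lecture_hall_polytope s"
  shows "x $ i = 0 \<or> x $ i = real (s i)"
proof -
  define r where "r i = x $ i / real (s i)" for i
  have x: "x $ i = real (s i) * r i" for i
    using pos[of i] by (simp add: r_def)
  have r: "0 \<le> r i" "r i \<le> 1" "i \<le> j \<Longrightarrow> r i \<le> r j" for i j
    using ext by (auto simp: extreme_point_of_def lecture_hall_polytope_def r_def)
  \<comment> \<open>Applying one monotone map of [0, 1] with fixed end points to all ratios
    preserves their order and the bounds 0 and 1, so it yields another point of the
    polytope.\<close>
  have mem: "(\<chi> i. real (s i) * g (r i)) \<in> lecture_hall_polytope s"
    if "g 0 = 0" "g 1 = 1" "\<And>a b. 0 \<le> a \<Longrightarrow> a \<le> b \<Longrightarrow> b \<le> 1 \<Longrightarrow> g a \<le> g b" for g :: "real \<Rightarrow> real"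
    using that(3)[of 0] that(3)[of _ 1] that(3) r pos
    by (auto simp: lecture_hall_polytope_def that(1,2) less_imp_neq[symmetric])
  txt \<open>Both \<open>a\<^sup>2\<close> and \<open>2a - a\<^sup>2\<close> map \<open>[0, 1]\<close> monotonically to itself, and \<open>a\<close> is their midpoint.\<close>
  define p where "p = (\<chi> i. real (s i) * (r i)\<^sup>2)"
  define q where "q = (\<chi> i. real (s i) * (1 - (1 - r i)\<^sup>2))"
  have "p \<in> lecture_hall_polytope s"
    unfolding p_def by (rule mem) (auto intro: power_mono)
  moreover have "q \<in> lecture_hall_polytope s"
    unfolding q_def by (rule mem) (auto intro: power_mono)
  moreover have "x = midpoint p q"
    by (simp add: vec_eq_iff midpoint_def p_def q_def x power2_eq_square algebra_simps)
  \<comment> \<open>If \<open>p\<close> and \<open>q\<close> differed, \<open>x\<close> would lie in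
    the open segment between them. Their equality forces every ratio to be 0 or 1, the only
    solutions of a = a^2.\<close>
  ultimately have "p = q"
    using ext unfolding extreme_point_of_def by (metis midpoint_in_open_segment)
  then have "real (s i) * (r i)\<^sup>2 = real (s i) * (1 - (1 - r i)\<^sup>2)"
    unfolding p_def q_def vec_eq_iff by simp
  then have "(r i)\<^sup>2 = 1 - (1 - r i)\<^sup>2" using pos[of i] by simp
  then have "r i * (r i - 1) = 0" by (simp add: power2_eq_square algebra_simps)
  then show ?thesis by (auto simp: x)
qed

lemma lattice_polytope_lecture_hall_polytope:
  fixes s :: "'n::{finite,linorder} \<Rightarrow> nat"
  assumes "\<And>i. 0 < s i"
  shows "lattice_polytope (lecture_hall_polytope s)"
proof -
  let ?V = "{x. x extreme_point_of lecture_hall_polytope s}"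
  \<comment> \<open>An extreme point is determined by its set of nonzero coordinates, and there are
    only finitely many such sets.\<close>
  have "x \<in> range (\<lambda>S. \<chi> i. if i \<in> S then real (s i) else 0)" if "x \<in> ?V" for x
    using extreme_point_lecture_hall_polytope[where s = s, OF assms] that assms
    by (intro image_eqI[where x = "{i. x $ i \<noteq> 0}"]) (auto simp: vec_eq_iff)
  then have "finite ?V"
    by (meson finite finite_imageI finite_subset subsetI)
  moreover have "integer_vector x" if "x \<in> ?V" for x
    using extreme_point_lecture_hall_polytope[where s = s, OF assms] that
    unfolding integer_vector_def by (metis Ints_0 Ints_of_nat mem_Collect_eq)
  \<comment> \<open>A compact convex set is the convex hull of its extreme points.\<close>
  moreover have "lecture_hall_polytope s = convex hull ?V"
    by (rule Krein_Milman_Minkowski)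
      (simp_all add: assms compact_lecture_hall_polytope convex_lecture_hall_polytope)
  ultimately show ?thesis unfolding lattice_polytope_def by blast
qed

lemma full_dim_lattice_polytope_lecture_hall_polytope:
  fixes s :: "'n::{finite,linorder} \<Rightarrow> nat"
  assumes "\<And>i. 0 < s i"
  shows "full_dim_lattice_polytope (lecture_hall_polytope s)"
proof -
  \<comment> \<open>Here \<open>card {..i}\<close> is the rank of \<open>i\<close>, counted from 1
    to d, so the ratios are 1/(d+1), ..., d/(d+1). The denominator d+1 keeps the last one below 1.
    An interior point yields full dimension.\<close>
  define x :: "real ^ 'n::{finite,linorder}" where
    "x = (\<chi> i. real (s i) * (real (card {..i}) / real (Suc CARD('n))))"
  have x: "x $ i / real (s i) = real (card {..i}) / real (Suc CARD('n))" for i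
    using assms[of i] by (simp add: x_def)
  have "x \<in> interior (lecture_hall_polytope s)"
  proof (rule interior_lecture_hall_polytopeI; unfold x)
    fix i j :: 'n
    have "0 < card {..i}" by (simp add: card_gt_0_iff)
    then show "0 < real (card {..i}) / real (Suc CARD('n))" by simp
    have "card {..i} \<le> CARD('n)" by (rule card_mono) auto
    then show "real (card {..i}) / real (Suc CARD('n)) < 1" by simp
    assume "i < j"
    then have "card {..i} < card {..j}" by (intro psubset_card_mono) auto
    then show "real (card {..i}) / real (Suc CARD('n)) < real (card {..j}) / real (Suc CARD('n))"
      by (simp add: divide_strict_right_mono)
  qed
  then have "aff_dim (lecture_hall_polytope s) = int CARD('n)"
    using aff_dim_nonempty_interior[of "lecture_hall_polytope s"] by auto
  then show ?thesis
    using lattice_polytope_lecture_hall_polytope[OF assms]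
    by (simp add: full_dim_lattice_polytope_def)
qed

section \<open>Gorenstein index in terms of reflexivity up to translation\<close>

lemma gorenstein_of_index_lecture_hall_polytope:
  fixes s :: "'n::{finite,linorder} \<Rightarrow> nat"
  assumes pos: "\<And>i. 0 < s i" and "0 < c"
  shows "gorenstein_of_index c (lecture_hall_polytope s) \<longleftrightarrow>
    reflexive_up_to_translation (lecture_hall_polytope (\<lambda>i. c * s i))"
proof
  let ?P = "lecture_hall_polytope (\<lambda>i. c * s i)"
  {
    assume "gorenstein_of_index c (lecture_hall_polytope s)"
    then obtain U w where U: "unimodular_matrix U" and w: "integer_vector w"
      and refl: "reflexive ((\<lambda>v. v v* U + w) ` ?P)"
      using assms
      by (auto simp: gorenstein_of_index_def unimodularly_equivalent_def lecture_hall_polytope_scaled)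
    obtain V where V: "unimodular_matrix V" "U ** V = mat 1"
      using unimodular_matrix_inverse[OF U] by metis
    \<comment> \<open>Undoing the linear part turns the affine equivalence into a translation by the
      integer vector \<open>w v* V\<close>, and the image stays reflexive.\<close>
    have "(v v* U + w) v* V = v + w v* V" for v
      by (simp add: vector_matrix_left_distrib vector_matrix_mul_assoc V)
    then have "reflexive ((\<lambda>v. v + w v* V) ` ?P)"
      using reflexive_unimodular_image[OF refl V(1)] by (simp add: image_image)
    moreover have "integer_vector (w v* V)"
      using w V(1) by (auto simp: unimodular_matrix_def intro: integer_vector_vector_matrix_mult)
    ultimately show "reflexive_up_to_translation ?P"
      unfolding reflexive_up_to_translation_def by blast
  }
  assume "reflexive_up_to_translation ?P"
  then obtain w where w: "integer_vector w" and refl: "reflexive ((\<lambda>x. x + w) ` ?P)"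
    unfolding reflexive_up_to_translation_def by blast
  \<comment> \<open>Conversely, a translation is a unimodular equivalence whose linear part is the
    identity.\<close>
  have "unimodular_matrix (mat 1 :: real ^ 'n::{finite,linorder} ^ 'n::{finite,linorder})"
    by (simp add: unimodular_matrix_def) (simp add: mat_def)
  moreover have "(\<lambda>x. x + w) ` ?P = (\<lambda>v. v v* mat 1 + w) ` ?P" by simp
  moreover have "full_dim_lattice_polytope ?P"
    using assms by (intro full_dim_lattice_polytope_lecture_hall_polytope) simp
  ultimately have "unimodularly_equivalent ?P ((\<lambda>x. x + w) ` ?P)"
    using w refl unfolding unimodularly_equivalent_def reflexive_def fano_def by blast
  then show "gorenstein_of_index c (lecture_hall_polytope s)"
    using assms refl full_dim_lattice_polytope_lecture_hall_polytope[OF pos]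
    by (auto simp: gorenstein_of_index_def lecture_hall_polytope_scaled)
qed

section \<open>Interior lattice points and the bound on the index\<close>

lemma reflexive_up_to_translation_interior_unique:
  assumes "reflexive_up_to_translation P" "x \<in> interior P" "y \<in> interior P"
    "integer_vector x" "integer_vector y"
  shows "x = y"
proof -
  obtain w where w: "integer_vector w" and "reflexive ((\<lambda>x. x + w) ` P)"
    using assms(1) unfolding reflexive_up_to_translation_def by blast
  then have *: "interior ((\<lambda>x. x + w) ` P) \<inter> {x. integer_vector x} = {0}"
    by (simp add: reflexive_def fano_interior)
  have "interior ((\<lambda>x. x + w) ` P) = (\<lambda>x. x + w) ` interior P"
    using interior_translation[of w P] by (simp add: add.commute)
  \<comment> \<open>The shift sends an interior lattice point to one of the reflexive translate,
    which can only be 0; thus every such point equals \<open>- w\<close>.\<close>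
  then have "z + w = 0" if "z \<in> interior P" "integer_vector z" for z
    using * that w by (auto simp: integer_vector_def set_eq_iff image_iff)
  then show ?thesis using assms by (metis add_right_cancel)
qed

lemma interior_lattice_point_strict_mono:
  fixes s :: "'n::{finite,linorder} \<Rightarrow> nat"
  assumes "strict_mono s" "\<And>i. 0 < s i" "2 \<le> k" "k \<le> c"
  shows "(\<chi> i. real k * real (s i) - 1) \<in> interior (lecture_hall_polytope (\<lambda>i. c * s i))"
proof (rule interior_lecture_hall_polytopeI)
  have c: "0 < c" using assms(3,4) by simp
  have eq: "(\<chi> i. real k * real (s i) - 1) $ i / real (c * s i) = (real k - 1 / real (s i)) / real c" for i
    using assms(2)[of i] c by (simp add: field_simps)
  fix i j :: 'n
  \<comment> \<open>The value \<open>s i = 1\<close> is possible, so the subtracted term can be as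
    large as 1; this is where \<open>2 \<le> k\<close> secures strict positivity.\<close>
  have "1 / real (s i) \<le> 1" using assms(2)[of i] by simp
  then have "0 < real k - 1 / real (s i)" using assms(3) by simp
  then show "0 < (\<chi> i. real k * real (s i) - 1) $ i / real (c * s i)"
    unfolding eq using c by simp
  have "real k - 1 / real (s i) < real c" using assms(2)[of i] assms(4)
    by (smt (verit) of_nat_0_less_iff of_nat_mono zero_less_divide_1_iff)
  then show "(\<chi> i. real k * real (s i) - 1) $ i / real (c * s i) < 1"
    unfolding eq using c by simp
  assume "i < j"
  then have "1 / real (s j) < 1 / real (s i)"
    using assms(1) assms(2)[of i] by (simp add: strict_mono_def frac_less2)
  then show "(\<chi> i. real k * real (s i) - 1) $ i / real (c * s i) < (\<chi> i. real k * real (s i) - 1) $ j / real (c * s j)"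
    unfolding eq using c by (simp add: divide_strict_right_mono)
qed

theorem corollary2p4:
  shows "(\<forall>s :: 'n::{finite,linorder} \<Rightarrow> nat.
            strict_mono s \<and> (\<forall>i. 0 < s i) \<longrightarrow>
              (gorenstein_of_index 2 (lecture_hall_polytope s) \<longleftrightarrow>
               (\<exists>t :: 'n \<Rightarrow> nat. (\<forall>i. 0 < t i) \<and> (\<forall>i. real (s i) = real (t i) / 2) \<and>
                  reflexive_up_to_translation (lecture_hall_polytope t))))
       \<and> \<not> (\<exists>(s :: 'n \<Rightarrow> nat) c.
            strict_mono s \<and> (\<forall>i. 0 < s i) \<and> 3 \<le> c \<and>
            gorenstein_of_index c (lecture_hall_polytope s))"
proof (intro conjI allI impI notI)
  fix s :: "'n \<Rightarrow> nat"
  assume "strict_mono s \<and> (\<forall>i. 0 < s i)"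
  then have pos: "\<And>i. 0 < s i" by simp
  \<comment> \<open>The condition determines \<open>t\<close> completely, so the existential
    collapses to the single candidate \<open>2 * s i\<close>, to which the criterion with
    \<open>c = 2\<close> applies.\<close>
  have "real (s i) = real (t i) / 2 \<longleftrightarrow> t i = 2 * s i" for t i
    by linarith
  then have t: "(\<forall>i. 0 < t i) \<and> (\<forall>i. real (s i) = real (t i) / 2) \<longleftrightarrow> t = (\<lambda>i. 2 * s i)" for t
    using pos by (auto simp: fun_eq_iff)
  show "gorenstein_of_index 2 (lecture_hall_polytope s) \<longleftrightarrow>
      (\<exists>t :: 'n \<Rightarrow> nat. (\<forall>i. 0 < t i) \<and> (\<forall>i. real (s i) = real (t i) / 2) \<and>
        reflexive_up_to_translation (lecture_hall_polytope t))"
    unfolding conj_assoc[symmetric] t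
    by (simp add: gorenstein_of_index_lecture_hall_polytope pos)
next
  assume "\<exists>(s :: 'n \<Rightarrow> nat) c. strict_mono s \<and> (\<forall>i. 0 < s i) \<and> 3 \<le> c \<and>
            gorenstein_of_index c (lecture_hall_polytope s)"
  then obtain s :: "'n \<Rightarrow> nat" and c where s: "strict_mono s" "\<And>i. 0 < s i" "3 \<le> c"
    and "gorenstein_of_index c (lecture_hall_polytope s)" by blast
  then have refl: "reflexive_up_to_translation (lecture_hall_polytope (\<lambda>i. c * s i))"
    using gorenstein_of_index_lecture_hall_polytope[where s = s, OF s(2), of c] by simp
  have int: "integer_vector (\<chi> i. real k * real (s i) - 1)" for k
    by (simp add: integer_vector_def)
  \<comment> \<open>Both \<open>k = 2\<close> and \<open>k = 3\<close> are admissible because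
    \<open>3 \<le> c\<close>. Uniqueness of the interior lattice point identifies the two vectors,
    which would force \<open>s i = 0\<close>.\<close>
  have "(\<chi> i. real 2 * real (s i) - 1) = (\<chi> i. real 3 * real (s i) - 1)"
    using s by (intro reflexive_up_to_translation_interior_unique[OF refl] int
        interior_lattice_point_strict_mono) auto
  then have "s i = 0" for i by (simp add: vec_eq_iff)
  then show False using s(2) by (metis less_numeral_extra(3))
qed

end
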